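(* Let $X$ be a compact Hausdorff space and let $\{f_n\}_{n=0}^{\infty}$ be a standard Parseval frame in a Hilbert $C(X)$-module $H$. Let $\theta_{f_n}:H\to C(X,H^2(\mathbb{D}))$, $\theta_{f_n}f=\sum_{n=0}^\infty\langle f,f_n\rangle w^n$, be its analysis operator. Suppose that $$\operatorname{Im}\theta_{f_n}=[b^x(w)C(X,H^2(\mathbb{D}))]^{\perp},$$ where for each $x\in X$, $b^x(w)$ is either an inner function with $b^x(0)=0$ or $b^x(w)=0$, and the family of measures $\{\mu_x\}_{x\in X}$ corresponding to these functions via the Herglotz theorem is weakly continuous. Then $\{f_n\}_{n=0}^{\infty}$ is the auxiliary sequence of an effective stationary sequence in $H$.
   Context: A Hilbert $C(X)$-module is a complex vector space and $C(X)$-module $H$ with a $C(X)$-valued inner product, $C(X)$-linear in the first variable, conjugate symmetric and positive definite, complete in the norm $\|f\|=\sqrt{\|\langle f,f\rangle\|_{C(X)}}$. A standard Parseval frame is a sequence $\{f_n\}\subseteq H$ with $\sum_{n=0}^\infty\langle f,f_n\rangle\langle f_n,f\rangle=\langle f,f\rangle$ for all $f\in H$, the sum converging in the norm of $C(X)$. A sequence $\{e_n\}_{n=0}^\infty\subseteq H$ is stationary if there is a $C(X)$-linear isometry $T:H\to H$ with $T^ne_0=e_n$ for all $n$. A sequence $\{e_n\}$ with $\langle e_n,e_n\rangle=1$ for all $n$ is effective if for every $f\in H$ the sequence $h_0=\langle f,e_0\rangle e_0$, $h_n=h_{n-1}+\langle f-h_{n-1},e_n\rangle e_n$ ($n\ge1$)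 converges to $f$ in norm; its auxiliary sequence is $g_0=e_0$, $g_n=e_n-\sum_{k=0}^{n-1}\langle e_n,e_k\rangle g_k$ for $n\ge1$. $H^2(\mathbb{D})$ is the Hardy space of functions $\sum_{n\ge0}a_nw^n$ on the unit disk $\mathbb{D}$ with $\sum|a_n|^2<\infty$ (norm $(\sum|a_n|^2)^{1/2}$); $C(X,H^2(\mathbb{D}))$ is the Hilbert $C(X)$-module of norm-continuous functions $X\to H^2(\mathbb{D})$ with pointwise inner product; $\sum_n\langle f,f_n\rangle w^n$ denotes the function $x\mapsto\sum_n\langle f,f_n\rangle(x)w^n$. An inner function is a bounded analytic $b$ on $\mathbb{D}$ with $\|bf\|_{H^2(\mathbb{D})}=\|f\|_{H^2(\mathbb{D})}$ for all $f\in H^2(\mathbb{D})$. Herglotz theorem: Borel probability measures $\mu$ on $[0,1)$ correspond one-to-one to analytic functions $b$ on $\mathbb{D}$ bounded by one with $b(0)=0$ via $\frac{1+b(w)}{1-b(w)}=\int_0^1\frac{1+we^{-2\pi i y}}{1-we^{-2\pi i y}}\,d\mu(y)$; singular measures (with respect to Lebesgue measure) correspond to inner functions vanishing at $0$, and Lebesgue measure to $b=0$. The family $\{\mu_x\}$ is weakly continuous if $x\mapsto\int_0^1g\,d\mu_x$ is continuous for every $g\in C_b([0,1))$. $[b^x(w)C(X,H^2(\mathbb{D}))]^\perp$ is the set of $h\in C(X,H^2(\mathbb{D}))$ such that $\langle h(x),b^x f(x)\rangle_{H^2(\mathbb{D})}=0$ for all $x\in X$ and all $f\in C(X,H^2(\mathbb{D}))$.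 *)

theory Defs
  imports
    "HOL-Complex_Analysis.Complex_Analysis"
    "HOL-Probability.Probability_Measure"
begin

section \<open>The ring of continuous functions on a compact space\<close>

text \<open>
  On a compact space every continuous function is bounded, so for compact \<open>X\<close> the type
  \<open>X \<Rightarrow>\<^sub>C complex\<close> with its supremum norm is \<open>C(X)\<close>. The library provides the normed space; the
  pointwise ring structure is added here.
\<close>

instantiation bcontfun :: (topological_space, real_normed_field) comm_ring_1
begin

context includes bcontfun.lifting
begin

lift_definition times_bcontfun :: "('a \<Rightarrow>\<^sub>C 'b) \<Rightarrow> ('a \<Rightarrow>\<^sub>C 'b) \<Rightarrow> 'a \<Rightarrow>\<^sub>C 'b"
  is "\<lambda>f g x. f x * g x"
proof -
  fix f g :: "'a \<Rightarrow> 'b"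
  assume "f \<in> bcontfun" "g \<in> bcontfun"
  then obtain a b where ab: "\<And>x. norm (f x) \<le> a" "\<And>x. norm (g x) \<le> b"
    and c: "continuous_on UNIV f" "continuous_on UNIV g"
    by (auto simp: bcontfun_def bounded_iff)
  have "norm (f x * g x) \<le> a * b" for x
    unfolding norm_mult
    using ab[of x] norm_ge_zero[of "f x"] by (intro mult_mono) (linarith | simp)+
  with c show "(\<lambda>x. f x * g x) \<in> bcontfun"
    by (intro bcontfun_normI[of _ "a * b"] continuous_intros)
qed

lift_definition one_bcontfun :: "'a \<Rightarrow>\<^sub>C 'b" is "\<lambda>_. 1"
  by (rule const_bcontfun)

end

lemmas [simp] = times_bcontfun.rep_eq one_bcontfun.rep_eq

instance
proof
  have "apply_bcontfun (0 :: 'a \<Rightarrow>\<^sub>C 'b) x \<noteq> apply_bcontfun (1 :: 'a \<Rightarrow>\<^sub>C 'b) x" for x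
    by simp
  then show "(0 :: 'a \<Rightarrow>\<^sub>C 'b) \<noteq> 1"
    by metis
qed (auto intro!: bcontfun_eqI simp: algebra_simps)

end


section \<open>Hilbert C(X)-modules\<close>

text \<open>
  The underlying set of the module is the type \<open>'h\<close>. The class \<open>banach\<close> contributes its addition, a
  norm, the topology of this norm and completeness; the locale axioms say that the norm is the
  one induced by the inner product and that real scaling is the restriction of complex scaling.
\<close>

locale hilbert_CX_module =
  complex_space: vector_space cscale + CX_module: module act
  for cscale :: "complex \<Rightarrow> 'h \<Rightarrow> 'h :: banach"
    and act :: "('x :: t2_space \<Rightarrow>\<^sub>C complex) \<Rightarrow> 'h \<Rightarrow> 'h" +
  fixes ip :: "'h \<Rightarrow> 'h \<Rightarrow> ('x \<Rightarrow>\<^sub>C complex)"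
  assumes cscale_of_real: "cscale (complex_of_real r) h = r *\<^sub>R h"
    and act_const: "act (const_bcontfun c) h = cscale c h"
    and ip_add_left: "ip (f + g) h = ip f h + ip g h"
    and ip_act_left: "ip (act a f) g = a * ip f g"
    and ip_cnj: "apply_bcontfun (ip g f) x = cnj (apply_bcontfun (ip f g) x)"
    and ip_nonneg: "apply_bcontfun (ip f f) x \<in> \<real>\<^sub>\<ge>\<^sub>0"
    and ip_definite: "ip f f = 0 \<Longrightarrow> f = 0"
    and norm_eq: "norm f = sqrt (norm (ip f f))"

definition standard_parseval_frame ::
    "('h \<Rightarrow> 'h \<Rightarrow> ('x :: t2_space \<Rightarrow>\<^sub>C complex)) \<Rightarrow> (nat \<Rightarrow> 'h) \<Rightarrow> bool" where
  "standard_parseval_frame ip F \<longleftrightarrow> (\<forall>f. (\<lambda>n. ip f (F n) * ip (F n) f) sums ip f f)"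

definition stationary ::
    "(('x :: t2_space \<Rightarrow>\<^sub>C complex) \<Rightarrow> 'h \<Rightarrow> 'h :: banach) \<Rightarrow> (nat \<Rightarrow> 'h) \<Rightarrow> bool" where
  "stationary act e \<longleftrightarrow>
     (\<exists>T. module_hom act act T \<and> (\<forall>h. norm (T h) = norm h) \<and> (\<forall>n. (T ^^ n) (e 0) = e n))"

primrec kaczmarz ::
    "(('x :: t2_space \<Rightarrow>\<^sub>C complex) \<Rightarrow> 'h \<Rightarrow> 'h :: banach) \<Rightarrow> ('h \<Rightarrow> 'h \<Rightarrow> ('x \<Rightarrow>\<^sub>C complex)) \<Rightarrow>
     (nat \<Rightarrow> 'h) \<Rightarrow> 'h \<Rightarrow> nat \<Rightarrow> 'h" where
  "kaczmarz act ip e f 0 = act (ip f (e 0)) (e 0)"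
| "kaczmarz act ip e f (Suc n) =
     kaczmarz act ip e f n
       + act (ip (f - kaczmarz act ip e f n) (e (Suc n))) (e (Suc n))"

definition effective ::
    "(('x :: t2_space \<Rightarrow>\<^sub>C complex) \<Rightarrow> 'h \<Rightarrow> 'h :: banach) \<Rightarrow> ('h \<Rightarrow> 'h \<Rightarrow> ('x \<Rightarrow>\<^sub>C complex)) \<Rightarrow>
     (nat \<Rightarrow> 'h) \<Rightarrow> bool" where
  "effective act ip e \<longleftrightarrow>
     (\<forall>n. ip (e n) (e n) = 1) \<and> (\<forall>f. kaczmarz act ip e f \<longlonglongrightarrow> f)"

definition auxiliary_sequence ::
    "(('x :: t2_space \<Rightarrow>\<^sub>C complex) \<Rightarrow> 'h \<Rightarrow> 'h :: banach) \<Rightarrow> ('h \<Rightarrow> 'h \<Rightarrow> ('x \<Rightarrow>\<^sub>C complex)) \<Rightarrow>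
     (nat \<Rightarrow> 'h) \<Rightarrow> (nat \<Rightarrow> 'h) \<Rightarrow> bool" where
  "auxiliary_sequence act ip e g \<longleftrightarrow>
     g 0 = e 0 \<and> (\<forall>n\<ge>1. g n = e n - (\<Sum>k<n. act (ip (e n) (e k)) (g k)))"


section \<open>The Hardy space of the disk\<close>

text \<open>
  A function on the open unit disk is represented by a function on the plane that vanishes off the
  disk, so that equality in HOL is equality on the disk.
\<close>

definition hardy :: "(complex \<Rightarrow> complex) set" where
  "hardy = {f. (\<exists>a. summable (\<lambda>n. (cmod (a n))\<^sup>2) \<and> (\<forall>w\<in>ball 0 1. (\<lambda>n. a n * w ^ n) sums f w))
             \<and> (\<forall>w. w \<notin> ball 0 1 \<longrightarrow> f w = 0)}"

definition hardy_coeff :: "(complex \<Rightarrow> complex) \<Rightarrow> nat \<Rightarrow> complex" where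
  "hardy_coeff f n = fps_nth (fps_expansion f 0) n"

definition hardy_inner :: "(complex \<Rightarrow> complex) \<Rightarrow> (complex \<Rightarrow> complex) \<Rightarrow> complex" where
  "hardy_inner f g = (\<Sum>n. hardy_coeff f n * cnj (hardy_coeff g n))"

definition hardy_norm :: "(complex \<Rightarrow> complex) \<Rightarrow> real" where
  "hardy_norm f = sqrt (\<Sum>n. (cmod (hardy_coeff f n))\<^sup>2)"

definition continuous_hardy :: "('x :: t2_space \<Rightarrow> complex \<Rightarrow> complex) set" where
  "continuous_hardy =
     {h. (\<forall>x. h x \<in> hardy) \<and> (\<forall>x. ((\<lambda>y. hardy_norm (\<lambda>w. h y w - h x w)) \<longlongrightarrow> 0) (at x))}"

definition analysis_operator ::
    "('h \<Rightarrow> 'h \<Rightarrow> ('x :: t2_space \<Rightarrow>\<^sub>C complex)) \<Rightarrow> (nat \<Rightarrow> 'h) \<Rightarrow> 'h \<Rightarrow> 'x \<Rightarrow> complex \<Rightarrow> complex" where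
  "analysis_operator ip F f =
     (\<lambda>x w. if w \<in> ball 0 1 then \<Sum>n. apply_bcontfun (ip f (F n)) x * w ^ n else 0)"

text \<open>Here and below only the values on the disk of the functions \<open>b\<close> matter.\<close>

definition inner_function :: "(complex \<Rightarrow> complex) \<Rightarrow> bool" where
  "inner_function b \<longleftrightarrow>
     b holomorphic_on ball 0 1 \<and> bounded (b ` ball 0 1) \<and>
     (\<forall>f\<in>hardy. hardy_norm (\<lambda>w. b w * f w) = hardy_norm f)"

definition orth_complement ::
    "('x :: t2_space \<Rightarrow> complex \<Rightarrow> complex) \<Rightarrow> ('x \<Rightarrow> complex \<Rightarrow> complex) set" where
  "orth_complement b =
     {h \<in> continuous_hardy.
        \<forall>x. \<forall>f\<in>continuous_hardy. hardy_inner (h x) (\<lambda>w. b x w * f x w) = 0}"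


section \<open>Herglotz measures\<close>

definition herglotz_measure :: "real measure \<Rightarrow> (complex \<Rightarrow> complex) \<Rightarrow> bool" where
  "herglotz_measure \<mu> b \<longleftrightarrow>
     prob_space \<mu> \<and> sets \<mu> = sets (restrict_space borel {0..<1}) \<and>
     b holomorphic_on ball 0 1 \<and> (\<forall>w\<in>ball 0 1. cmod (b w) \<le> 1) \<and> b 0 = 0 \<and>
     (\<forall>w\<in>ball 0 1. (1 + b w) / (1 - b w) =
        (\<integral>y. (1 + w * exp (- 2 * pi * \<i> * y)) / (1 - w * exp (- 2 * pi * \<i> * y)) \<partial>\<mu>))"

text \<open>Test functions are continuous on \<open>[0,1)\<close>; no compatibility at the two ends is required.\<close>

definition weakly_continuous :: "('x :: t2_space \<Rightarrow> real measure) \<Rightarrow> bool" where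
  "weakly_continuous \<mu> \<longleftrightarrow>
     (\<forall>g :: real \<Rightarrow> complex. continuous_on {0..<1} g \<longrightarrow> bounded (g ` {0..<1}) \<longrightarrow>
        continuous_on UNIV (\<lambda>x. \<integral>y. g y \<partial>\<mu> x))"

end

theory Submission
  imports Defs
begin

text \<open>
  Write \<open>\<beta>\<close> for the Taylor coefficients of \<open>b x\<close> and \<open>m\<close> for the moments
  \<open>\<integral> exp (- 2 \<pi> \<i> n y) d\<mu> x\<close>. The analysis operator identifies the module with the
  continuous sections of the model spaces \<open>H\<^sup>2 \<ominus> b x H\<^sup>2\<close>, and \<open>F n\<close> represents the
  functional ``\<open>n\<close>-th coefficient''. So \<open>F n\<close> has to correspond to the projection of
  \<open>w ^ n\<close> onto the model space, provided that this projection is a continuous section. It is: its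
  coefficients are polynomials in the \<open>\<beta> k\<close> and their conjugates, the \<open>\<beta> k\<close> are polynomials in
  the moments by the Herglotz formula, the moments are continuous by weak continuity, and the
  squared norm of the projection is its own \<open>n\<close>-th coefficient, so that coordinatewise convergence
  improves to convergence in norm (\<open>model_monomial_continuous\<close>). This gives the Gram matrix
  of the frame, \<open>I - B B\<^sup>*\<close> with \<open>B\<close> the lower triangular Toeplitz matrix of \<open>cnj \<beta>\<close>
  (\<open>frame_gram_of_analysis_range\<close>).

  A sequence with auxiliary sequence \<open>F\<close> and spectral measures \<open>\<mu> x\<close> must be \<open>e = M F\<close>, where
  \<open>M\<close> is the lower triangular Toeplitz matrix of \<open>cnj m\<close>; its entries lie in \<open>C(X)\<close>. The
  Herglotz formula says \<open>M = (I - B)\<^sup>-\<^sup>1\<close>, so the Gram matrix of \<open>e\<close> is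
  \<open>M (I - B B\<^sup>*) M\<^sup>* = M + M\<^sup>* - I\<close>, which is Toeplitz with unit diagonal
  (\<open>toeplitz_gram\<close>).

  The rest holds in any Hilbert \<open>C(X)\<close>-module. For unit vectors \<open>e n\<close> with auxiliary sequence
  \<open>F\<close>, the squared norm of the Kaczmarz residual of \<open>f\<close> is the remainder of the Parseval series
  of \<open>f\<close>, so the Parseval identity is effectiveness (\<open>effective_of_parseval\<close>), and
  \<open>f = \<Sum>k. \<langle>f, F k\<rangle> e k\<close>. As the Gram matrix is Toeplitz, \<open>f \<mapsto> \<Sum>k. \<langle>f, F k\<rangle> e (k + 1)\<close>
  is an isometry shifting \<open>e\<close> (\<open>stationary_of_toeplitz\<close>).
\<close>

section \<open>Square-summable sequences\<close>

abbreviation square_summable :: "(nat \<Rightarrow> complex) \<Rightarrow> bool" where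
  "square_summable a \<equiv> summable (\<lambda>n. (cmod (a n))\<^sup>2)"

lemma cmod_add_square: "(cmod (x + y))\<^sup>2 = (cmod x)\<^sup>2 + (cmod y)\<^sup>2 + 2 * Re (x * cnj y)"
  by (simp add: cmod_power2) (simp add: power2_eq_square algebra_simps)

lemma square_summable_mult:
  assumes "square_summable a" "square_summable b"
  shows "summable (\<lambda>n. a n * cnj (b n))"
proof (rule summable_comparison_test')
  show "summable (\<lambda>n. (cmod (a n))\<^sup>2 + (cmod (b n))\<^sup>2)"
    using assms by (rule summable_add)
  show "norm (a n * cnj (b n)) \<le> (cmod (a n))\<^sup>2 + (cmod (b n))\<^sup>2" for n
    using sum_squares_bound[of "cmod (a n)" "cmod (b n)"]
      zero_le_power2[of "cmod (a n)"] zero_le_power2[of "cmod (b n)"]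
    unfolding norm_mult complex_mod_cnj by linarith
qed

lemma square_norm_add_sums:
  assumes "square_summable a" "square_summable b"
  shows "(\<lambda>n. (cmod (a n + t * b n))\<^sup>2) sums
    ((\<Sum>n. (cmod (a n))\<^sup>2) + (cmod t)\<^sup>2 * (\<Sum>n. (cmod (b n))\<^sup>2)
      + 2 * Re (cnj t * (\<Sum>n. a n * cnj (b n))))"
proof -
  have "(\<lambda>n. (cmod (a n))\<^sup>2 + (cmod t)\<^sup>2 * (cmod (b n))\<^sup>2 + 2 * Re (cnj t * (a n * cnj (b n)))) sums
    ((\<Sum>n. (cmod (a n))\<^sup>2) + (cmod t)\<^sup>2 * (\<Sum>n. (cmod (b n))\<^sup>2)
      + 2 * Re (cnj t * (\<Sum>n. a n * cnj (b n))))"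
    by (intro sums_add sums_mult summable_sums sums_Re square_summable_mult assms)
  then show ?thesis
    by (simp add: cmod_add_square norm_mult power_mult_distrib mult_ac)
qed

lemma square_summable_diff:
  assumes "square_summable a" "square_summable b"
  shows "square_summable (\<lambda>n. a n - b n)"
  using square_norm_add_sums[OF assms, of "-1"] by (simp add: sums_iff)

lemma eq_by_polarization:
  assumes "\<And>t. cmod t = 1 \<Longrightarrow> Re (cnj t * z) = Re (cnj t * z')"
  shows "z = z'"
  using assms[of 1] assms[of \<i>] by (simp add: complex_eq_iff)

text \<open>
  The Radon--Riesz property: the tail of \<open>a y\<close> is its squared norm minus finitely many
  terms, so convergence of the norm and of the coordinates makes the tails of \<open>a y\<close>
  uniformly as small as those of the limit.
\<close>

lemma square_norm_diff_tendsto_0: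
  fixes a :: "'i \<Rightarrow> nat \<Rightarrow> complex"
  assumes a: "\<And>y. square_summable (a y)" and c: "square_summable c"
    and coord: "\<And>n. ((\<lambda>y. a y n) \<longlongrightarrow> c n) F"
    and norm: "((\<lambda>y. \<Sum>n. (cmod (a y n))\<^sup>2) \<longlongrightarrow> (\<Sum>n. (cmod (c n))\<^sup>2)) F"
  shows "((\<lambda>y. \<Sum>n. (cmod (a y n - c n))\<^sup>2) \<longlongrightarrow> 0) F"
proof (rule order_tendstoI)
  fix e :: real
  assume "e < 0"
  have "0 \<le> (\<Sum>n. (cmod (a y n - c n))\<^sup>2)" for y
    by (intro suminf_nonneg square_summable_diff a c) auto
  with \<open>e < 0\<close> show "\<forall>\<^sub>F y in F. e < (\<Sum>n. (cmod (a y n - c n))\<^sup>2)"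
    by (intro always_eventually allI) (rule less_le_trans)
next
  fix e :: real
  assume "0 < e"
  define tail where "tail d N = (\<Sum>n. (cmod (d n))\<^sup>2) - (\<Sum>n<N. (cmod (d n))\<^sup>2)"
    for d :: "nat \<Rightarrow> complex" and N
  have "(\<lambda>N. tail c N) \<longlonglongrightarrow> (\<Sum>n. (cmod (c n))\<^sup>2) - (\<Sum>n. (cmod (c n))\<^sup>2)"
    unfolding tail_def using c by (intro tendsto_intros summable_LIMSEQ)
  then have "(\<lambda>N. tail c N) \<longlonglongrightarrow> 0"
    by simp
  then have "\<forall>\<^sub>F N in sequentially. tail c N < e / 4"
    using \<open>0 < e\<close> by (intro order_tendstoD) auto
  then obtain N where N: "tail c N < e / 4"
    by (auto simp: eventually_sequentially)
  define U where "U y = (\<Sum>n<N. (cmod (a y n - c n))\<^sup>2) + 2 * tail (a y) N + 2 * tail c N" for y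
  have upper: "(\<Sum>n. (cmod (a y n - c n))\<^sup>2) \<le> U y" for y
  proof -
    have par: "(cmod (a y n - c n))\<^sup>2 \<le> 2 * (cmod (a y n))\<^sup>2 + 2 * (cmod (c n))\<^sup>2" for n
      using cmod_add_square[of "a y n" "c n"] cmod_add_square[of "a y n" "- c n"]
        zero_le_power2[of "cmod (a y n + c n)"] by simp
    have split: "(\<Sum>n. (cmod (d (n + N)))\<^sup>2) = tail d N" if "square_summable d" for d
      using suminf_split_initial_segment[OF that, of N] by (simp add: tail_def)
    have s: "summable (\<lambda>n. (cmod (a y (n + N)))\<^sup>2)" "summable (\<lambda>n. (cmod (c (n + N)))\<^sup>2)"
      "summable (\<lambda>n. (cmod (a y (n + N) - c (n + N)))\<^sup>2)"
      using a c square_summable_diff[OF a c] by (simp_all add: summable_iff_shift[of "\<lambda>n. (cmod (_ n))\<^sup>2"]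
        summable_iff_shift[of "\<lambda>n. (cmod (_ n - _ n))\<^sup>2"])
    have "(\<Sum>n. (cmod (a y (n + N) - c (n + N)))\<^sup>2)
        \<le> (\<Sum>n. 2 * (cmod (a y (n + N)))\<^sup>2 + 2 * (cmod (c (n + N)))\<^sup>2)"
      by (intro suminf_le par s summable_add summable_mult)
    also have "\<dots> = 2 * tail (a y) N + 2 * tail c N"
      using s by (simp add: suminf_add[symmetric] suminf_mult summable_mult split a c)
    finally show ?thesis
      using suminf_split_initial_segment[OF square_summable_diff[OF a c], of y N]
      by (simp add: U_def)
  qed
  have "(U \<longlongrightarrow> (\<Sum>n<N. (cmod (c n - c n))\<^sup>2) + 2 * tail c N + 2 * tail c N) F"
    unfolding U_def tail_def by (intro tendsto_intros coord norm)
  then have "\<forall>\<^sub>F y in F. U y < e"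
    by (rule order_tendstoD(2)) (use N in simp)
  then show "\<forall>\<^sub>F y in F. (\<Sum>n. (cmod (a y n - c n))\<^sup>2) < e"
    by eventually_elim (use upper in \<open>auto intro: le_less_trans\<close>)
qed


section \<open>Power series on circles\<close>

lemma has_integral_cis_multiple:
  assumes "k \<noteq> (0 :: int)"
  shows "((\<lambda>t. z * cis (of_int k * t)) has_integral 0) {0..2 * pi}"
proof -
  have "((\<lambda>t. z * cis (of_int k * t)) has_integral
      z * cis (of_int k * (2 * pi)) / (\<i> * of_int k) - z * cis (of_int k * 0) / (\<i> * of_int k))
      {0..2 * pi}"
  proof (rule fundamental_theorem_of_calculus)
    fix t :: real
    have "((\<lambda>w. z * exp (\<i> * (of_int k * w)) / (\<i> * of_int k)) has_field_derivative
        z * exp (\<i> * (of_int k * of_real t))) (at (of_real t))"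
      using assms by (auto intro!: derivative_eq_intros simp: field_simps)
    from has_vector_derivative_real_field[OF this]
    show "((\<lambda>t. z * cis (of_int k * t) / (\<i> * of_int k)) has_vector_derivative
        z * cis (of_int k * t)) (at t within {0..2 * pi})"
      by (simp add: cis_conv_exp)
  qed simp
  moreover have "cis (of_int k * (2 * pi)) = 1"
    using cis_multiple_2pi[of "of_int k"] by (simp add: mult_ac)
  ultimately show ?thesis
    by simp
qed

lemma polynomial_parseval:
  "((\<lambda>t. (cmod (\<Sum>n<N. c n * cis (of_nat n * t)))\<^sup>2) has_integral
     2 * pi * (\<Sum>n<N. (cmod (c n))\<^sup>2)) {0..2 * pi}"
proof (induction N)
  case 0
  then show ?case by simp
next
  case (Suc N)
  have "((\<lambda>t. 2 * Re (\<Sum>n<N. c n * cnj (c N) * cis (of_int (int n - int N) * t)))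
      has_integral 2 * Re (\<Sum>n<N. 0)) {0..2 * pi}"
    by (intro has_integral_mult_right has_integral_Re has_integral_sum has_integral_cis_multiple) auto
  moreover have "(\<Sum>n<N. c n * cnj (c N) * cis (of_int (int n - int N) * t))
      = (\<Sum>n<N. c n * cis (of_nat n * t)) * cnj (c N * cis (of_nat N * t))" for t
    unfolding sum_distrib_right
    by (intro sum.cong) (simp_all add: cis_cnj cis_mult left_diff_distrib mult.assoc mult.left_commute)
  ultimately have cross: "((\<lambda>t. 2 * Re ((\<Sum>n<N. c n * cis (of_nat n * t)) * cnj (c N * cis (of_nat N * t))))
      has_integral 0) {0..2 * pi}"
    by (simp only:) simp
  have const: "((\<lambda>t. (cmod (c N))\<^sup>2) has_integral 2 * pi * (cmod (c N))\<^sup>2) {0..2 * pi}"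
    using has_integral_const_real[of "(cmod (c N))\<^sup>2" 0 "2 * pi"] by simp
  show ?case
    using has_integral_add[OF has_integral_add[OF Suc const] cross]
    by (simp add: cmod_add_square norm_mult distrib_left del: complex_cnj_mult times_complex.sel)
qed

text \<open>
  The identity passes from the partial sums, which converge boundedly on the circle.
\<close>

lemma circle_parseval:
  assumes f: "\<And>w. w \<in> ball 0 1 \<Longrightarrow> (\<lambda>n. a n * w ^ n) sums f w" and r: "0 \<le> r" "r < 1"
  shows "(\<lambda>t. (cmod (f (of_real r * cis t)))\<^sup>2) integrable_on {0..2 * pi}"
    and "(\<lambda>n. (cmod (a n))\<^sup>2 * r ^ (2 * n)) sums
      (integral {0..2 * pi} (\<lambda>t. (cmod (f (of_real r * cis t)))\<^sup>2) / (2 * pi))"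
proof -
  define c where "c n = a n * of_real (r ^ n)" for n
  define S where "S N t = (\<Sum>n<N. c n * cis (of_nat n * t))" for N t
  \<comment> \<open>Convergence at a larger radius gives absolute convergence at \<open>r\<close>, hence a uniform bound.\<close>
  obtain s where s: "r < s" "s < 1"
    using dense r by blast
  have "summable (\<lambda>n. a n * of_real s ^ n)"
    using f[of "of_real s"] s r by (auto simp: sums_iff)
  then have sum: "summable (\<lambda>n. cmod (c n))"
    using powser_insidea[of a "of_real s" "of_real r"] s r by (simp add: c_def)
  have "c n * cis (of_nat n * t) = a n * (of_real r * cis t) ^ n" for n t
    by (simp add: c_def power_mult_distrib Complex.DeMoivre)
  then have S: "(\<lambda>N. S N t) \<longlonglongrightarrow> f (of_real r * cis t)" for t
    using f[of "of_real r * cis t"] r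
    by (simp add: sums_def S_def norm_mult)
  have bound: "cmod (S N t) \<le> (\<Sum>n. cmod (c n))" for N t
  proof -
    have "cmod (S N t) \<le> (\<Sum>n<N. cmod (c n))"
      unfolding S_def by (rule norm_sum[THEN order_trans]) (simp add: norm_mult)
    also have "\<dots> \<le> (\<Sum>n. cmod (c n))"
      using sum by (intro sum_le_suminf) auto
    finally show ?thesis .
  qed
  have int: "((\<lambda>t. (cmod (S N t))\<^sup>2) has_integral 2 * pi * (\<Sum>n<N. (cmod (c n))\<^sup>2)) {0..2 * pi}" for N
    unfolding S_def by (rule polynomial_parseval)
  note * = dominated_convergence[where f = "\<lambda>N t. (cmod (S N t))\<^sup>2" and S = "{0..2 * pi}"
      and h = "\<lambda>_. (\<Sum>n. cmod (c n))\<^sup>2" and g = "\<lambda>t. (cmod (f (of_real r * cis t)))\<^sup>2"]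
  have lim: "(\<lambda>N. (cmod (S N t))\<^sup>2) \<longlonglongrightarrow> (cmod (f (of_real r * cis t)))\<^sup>2" for t
    by (intro tendsto_intros S)
  have le: "norm ((cmod (S N t))\<^sup>2) \<le> (\<Sum>n. cmod (c n))\<^sup>2" for N t
    using bound by (simp add: power_mono)
  show "(\<lambda>t. (cmod (f (of_real r * cis t)))\<^sup>2) integrable_on {0..2 * pi}"
    using lim le has_integral_integrable[OF int] by (intro *(1)) (auto intro: integrable_const_ivl)
  have "(\<lambda>N. integral {0..2 * pi} (\<lambda>t. (cmod (S N t))\<^sup>2)) \<longlonglongrightarrow>
      integral {0..2 * pi} (\<lambda>t. (cmod (f (of_real r * cis t)))\<^sup>2)"
    using lim le has_integral_integrable[OF int] by (intro *(2)) (auto intro: integrable_const_ivl)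
  then have "(\<lambda>N. 2 * pi * (\<Sum>n<N. (cmod (c n))\<^sup>2) / (2 * pi)) \<longlonglongrightarrow>
      integral {0..2 * pi} (\<lambda>t. (cmod (f (of_real r * cis t)))\<^sup>2) / (2 * pi)"
    by (intro tendsto_divide) (auto simp: integral_unique[OF int])
  moreover have "(cmod (c n))\<^sup>2 = (cmod (a n))\<^sup>2 * r ^ (2 * n)" for n
    using r by (simp add: c_def norm_mult power_mult_distrib norm_power power_mult[symmetric] mult.commute)
  ultimately show "(\<lambda>n. (cmod (a n))\<^sup>2 * r ^ (2 * n)) sums
      (integral {0..2 * pi} (\<lambda>t. (cmod (f (of_real r * cis t)))\<^sup>2) / (2 * pi))"
    by (simp add: sums_def)
qed

text \<open>
  On each circle of radius \<open>r < 1\<close> Parseval's identity turns the pointwise bound into a bound for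
  the sums weighted by \<open>r ^ (2 * n)\<close>; then \<open>r\<close> tends to 1 in every finite partial sum.
\<close>

lemma square_summable_of_pointwise_le:
  assumes f: "\<And>w. w \<in> ball 0 1 \<Longrightarrow> (\<lambda>n. a n * w ^ n) sums f w"
    and g: "\<And>w. w \<in> ball 0 1 \<Longrightarrow> (\<lambda>n. c n * w ^ n) sums g w"
    and le: "\<And>w. w \<in> ball 0 1 \<Longrightarrow> cmod (f w) \<le> cmod (g w)"
    and c: "square_summable c"
  shows "square_summable a"
proof (rule summableI_nonneg_bounded)
  fix N
  have *: "(\<Sum>n<N. (cmod (a n))\<^sup>2 * r ^ (2 * n)) \<le> (\<Sum>n. (cmod (c n))\<^sup>2)" if r: "0 \<le> r" "r < 1" for r
  proof -
    note A = circle_parseval[OF f r] and C = circle_parseval[OF g r]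
    have "(\<Sum>n<N. (cmod (a n))\<^sup>2 * r ^ (2 * n)) \<le> (\<Sum>n. (cmod (a n))\<^sup>2 * r ^ (2 * n))"
      using A(2) r by (intro sum_le_suminf) (auto simp: sums_iff)
    also have "\<dots> \<le> (\<Sum>n. (cmod (c n))\<^sup>2 * r ^ (2 * n))"
      using A C r le
      by (auto simp: sums_iff norm_mult intro!: divide_right_mono integral_le power_mono)
    also have "\<dots> \<le> (\<Sum>n. (cmod (c n))\<^sup>2)"
    proof (rule suminf_le)
      show "(cmod (c n))\<^sup>2 * r ^ (2 * n) \<le> (cmod (c n))\<^sup>2" for n
        using r by (intro mult_left_le power_le_one) auto
    qed (use C c in \<open>auto simp: sums_iff\<close>)
    finally show ?thesis .
  qed
  have "((\<lambda>r. \<Sum>n<N. (cmod (a n))\<^sup>2 * r ^ (2 * n)) \<longlongrightarrow> (\<Sum>n<N. (cmod (a n))\<^sup>2 * 1 ^ (2 * n))) (at_left (1::real))"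
    by (intro tendsto_intros)
  moreover have "\<forall>\<^sub>F r in at_left (1::real). 0 \<le> r \<and> r < 1"
    by (auto simp: eventually_at_left[of 0] intro!: exI[of _ 0])
  then have "\<forall>\<^sub>F r in at_left (1::real). (\<Sum>n<N. (cmod (a n))\<^sup>2 * r ^ (2 * n)) \<le> (\<Sum>n. (cmod (c n))\<^sup>2)"
    by eventually_elim (use * in auto)
  ultimately show "(\<Sum>n<N. (cmod (a n))\<^sup>2) \<le> (\<Sum>n. (cmod (c n))\<^sup>2)"
    using tendsto_upperbound[of _ _ "at_left (1::real)"] by (simp add: trivial_limit_at_left_real)
qed auto


section \<open>The Hardy space as a space of coefficient sequences\<close>

lemma hardy_coeff_unique:
  assumes "\<And>w. w \<in> ball 0 1 \<Longrightarrow> (\<lambda>n. a n * w ^ n) sums f w"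
  shows "f has_fps_expansion Abs_fps a" and "hardy_coeff f = a"
proof -
  have "summable (\<lambda>n. a n * (1 / 2) ^ n)"
    using assms[of "1 / 2"] by (auto simp: sums_iff)
  then have "ereal (norm (1 / 2 :: complex)) \<le> conv_radius a"
    by (rule conv_radius_geI)
  then have "0 < fps_conv_radius (Abs_fps a)"
    by (auto simp: fps_conv_radius_def intro: less_le_trans[rotated])
  moreover have "\<forall>\<^sub>F w in nhds 0. w \<in> ball (0 :: complex) 1"
    by (intro eventually_nhds_in_open) auto
  then have "\<forall>\<^sub>F w in nhds 0. eval_fps (Abs_fps a) w = f w"
    by eventually_elim (use assms in \<open>auto simp: eval_fps_def sums_iff\<close>)
  ultimately show "f has_fps_expansion Abs_fps a"
    by (simp add: has_fps_expansion_def)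
  then show "hardy_coeff f = a"
    by (simp add: hardy_coeff_def fun_eq_iff fps_expansion_eqI)
qed

lemma hardy_coeff_sums_holomorphic:
  assumes "f holomorphic_on ball 0 1" "w \<in> ball 0 1"
  shows "(\<lambda>n. hardy_coeff f n * w ^ n) sums f w"
  using holomorphic_power_series[OF assms] by (simp add: hardy_coeff_def fps_expansion_def)

lemma hardyI:
  assumes "f holomorphic_on ball 0 1" "square_summable (hardy_coeff f)"
    and "\<And>w. w \<notin> ball 0 1 \<Longrightarrow> f w = 0"
  shows "f \<in> hardy"
  using assms hardy_coeff_sums_holomorphic[OF assms(1)] unfolding hardy_def by blast

lemma hardyD:
  assumes "f \<in> hardy"
  shows "square_summable (hardy_coeff f)"
    and "w \<in> ball 0 1 \<Longrightarrow> (\<lambda>n. hardy_coeff f n * w ^ n) sums f w"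
    and "w \<notin> ball 0 1 \<Longrightarrow> f w = 0"
    and "f has_fps_expansion Abs_fps (hardy_coeff f)"
    and "f holomorphic_on ball 0 1"
proof -
  obtain a where a: "square_summable a" "\<And>w. w \<in> ball 0 1 \<Longrightarrow> (\<lambda>n. a n * w ^ n) sums f w"
      "\<And>w. w \<notin> ball 0 1 \<Longrightarrow> f w = 0"
    using assms unfolding hardy_def by blast
  note c = hardy_coeff_unique[OF a(2)]
  show "square_summable (hardy_coeff f)" "w \<in> ball 0 1 \<Longrightarrow> (\<lambda>n. hardy_coeff f n * w ^ n) sums f w"
    "w \<notin> ball 0 1 \<Longrightarrow> f w = 0" "f has_fps_expansion Abs_fps (hardy_coeff f)"
    using a c by auto
  show "f holomorphic_on ball 0 1"
    using a(2) by (intro power_series_holomorphic[where a = a]) auto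
qed

definition hardy_series :: "(nat \<Rightarrow> complex) \<Rightarrow> complex \<Rightarrow> complex" where
  "hardy_series a = (\<lambda>w. if w \<in> ball 0 1 then \<Sum>n. a n * w ^ n else 0)"

lemma hardy_series:
  assumes "square_summable a"
  shows "hardy_series a \<in> hardy" and "hardy_coeff (hardy_series a) = a"
proof -
  have sums: "(\<lambda>n. a n * w ^ n) sums hardy_series a w" if "w \<in> ball 0 1" for w
  proof -
    have "(cmod w)\<^sup>2 < 1"
      using that by (simp add: power_less_one_iff)
    moreover have "(cmod (cnj (w ^ n)))\<^sup>2 = ((cmod w)\<^sup>2) ^ n" for n
      by (simp add: norm_power mult.commute flip: power_mult)
    ultimately have "square_summable (\<lambda>n. cnj (w ^ n))"
      by (simp add: summable_geometric)
    from square_summable_mult[OF assms this] show ?thesis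
      using that by (simp add: hardy_series_def summable_sums)
  qed
  then show "hardy_coeff (hardy_series a) = a"
    by (rule hardy_coeff_unique)
  show "hardy_series a \<in> hardy"
    unfolding hardy_def using assms sums by (auto simp: hardy_series_def)
qed

lemma hardy_lincomb:
  assumes "f \<in> hardy" "g \<in> hardy"
  shows "(\<lambda>w. f w + t * g w) \<in> hardy"
    and "hardy_coeff (\<lambda>w. f w + t * g w) n = hardy_coeff f n + t * hardy_coeff g n"
proof -
  have *: "hardy_coeff (\<lambda>w. f w + t * g w) = (\<lambda>n. hardy_coeff f n + t * hardy_coeff g n)"
  proof (rule hardy_coeff_unique)
    fix w :: complex
    assume w: "w \<in> ball 0 1"
    show "(\<lambda>n. (hardy_coeff f n + t * hardy_coeff g n) * w ^ n) sums (f w + t * g w)"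
      using sums_add[OF hardyD(2)[OF assms(1) w] sums_mult[OF hardyD(2)[OF assms(2) w], of t]]
      by (simp add: algebra_simps)
  qed
  then show "hardy_coeff (\<lambda>w. f w + t * g w) n = hardy_coeff f n + t * hardy_coeff g n"
    by simp
  show "(\<lambda>w. f w + t * g w) \<in> hardy"
  proof (rule hardyI)
    show "square_summable (hardy_coeff (\<lambda>w. f w + t * g w))"
      unfolding * using square_norm_add_sums[OF hardyD(1)[OF assms(1)] hardyD(1)[OF assms(2)]]
      by (rule sums_summable)
    show "(\<lambda>w. f w + t * g w) holomorphic_on ball 0 1"
      using hardyD(5)[OF assms(1)] hardyD(5)[OF assms(2)] by (intro holomorphic_intros)
  qed (use assms in \<open>auto simp: hardyD(3)\<close>)
qed

lemma hardy_coeff_zero: "hardy_coeff (\<lambda>w. 0) n = 0"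
  using hardy_coeff_unique(2)[of "\<lambda>_. 0" "\<lambda>_. 0"] by simp

lemma hardy_norm_square:
  assumes "f \<in> hardy"
  shows "(hardy_norm f)\<^sup>2 = (\<Sum>n. (cmod (hardy_coeff f n))\<^sup>2)"
  using suminf_nonneg[OF hardyD(1)[OF assms]] by (simp add: hardy_norm_def)

lemma hardy_norm_lincomb:
  assumes "f \<in> hardy" "g \<in> hardy"
  shows "(hardy_norm (\<lambda>w. f w + t * g w))\<^sup>2
    = (hardy_norm f)\<^sup>2 + (cmod t)\<^sup>2 * (hardy_norm g)\<^sup>2 + 2 * Re (cnj t * hardy_inner f g)"
  using square_norm_add_sums[OF hardyD(1)[OF assms(1)] hardyD(1)[OF assms(2)], of t] assms
  by (simp add: hardy_norm_square hardy_lincomb hardy_inner_def sums_iff)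

text \<open>
  Bounded functions multiply \<open>H\<^sup>2\<close> into itself; without this the inner products with
  \<open>b f\<close> would be sums of series that need not converge.
\<close>

lemma hardy_mult_bounded:
  assumes b: "b holomorphic_on ball 0 1" "\<forall>w\<in>ball 0 1. cmod (b w) \<le> 1" and f: "f \<in> hardy"
  shows "(\<lambda>w. b w * f w) \<in> hardy"
    and "hardy_coeff (\<lambda>w. b w * f w) n = (\<Sum>j\<le>n. hardy_coeff f j * hardy_coeff b (n - j))"
proof -
  have "b has_fps_expansion fps_expansion b 0"
    using b(1) by (intro has_fps_expansion_fps_expansion) auto
  then have "(\<lambda>w. f w * b w) has_fps_expansion Abs_fps (hardy_coeff f) * fps_expansion b 0"
    by (intro has_fps_expansion_mult hardyD(4) f)
  then have "hardy_coeff (\<lambda>w. f w * b w) n = (\<Sum>j\<le>n. hardy_coeff f j * hardy_coeff b (n - j))"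
    using fps_expansion_eqI
    by (simp add: hardy_coeff_def[of "\<lambda>w. f w * b w"] hardy_coeff_def[of b] fps_mult_nth atLeast0AtMost)
  then show "hardy_coeff (\<lambda>w. b w * f w) n = (\<Sum>j\<le>n. hardy_coeff f j * hardy_coeff b (n - j))"
    by (simp add: mult.commute)
  have hol: "(\<lambda>w. b w * f w) holomorphic_on ball 0 1"
    using b(1) hardyD(5)[OF f] by (intro holomorphic_intros)
  show "(\<lambda>w. b w * f w) \<in> hardy"
  proof (rule hardyI[OF hol])
    show "square_summable (hardy_coeff (\<lambda>w. b w * f w))"
    proof (rule square_summable_of_pointwise_le)
      fix w :: complex
      assume w: "w \<in> ball 0 1"
      show "(\<lambda>n. hardy_coeff (\<lambda>w. b w * f w) n * w ^ n) sums (b w * f w)"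
        by (rule hardy_coeff_sums_holomorphic[OF hol w])
      show "(\<lambda>n. hardy_coeff f n * w ^ n) sums f w"
        by (rule hardyD(2)[OF f w])
      show "cmod (b w * f w) \<le> cmod (f w)"
        using b(2) w by (simp add: norm_mult mult_left_le_one_le)
    qed (rule hardyD(1)[OF f])
  qed (use hardyD(3)[OF f] in auto)
qed

text \<open>
  An inner function preserves norms by definition, and norms determine inner products.
\<close>

lemma inner_function_isometry:
  assumes b: "inner_function b" "\<forall>w\<in>ball 0 1. cmod (b w) \<le> 1" and "f \<in> hardy" "g \<in> hardy"
  shows "hardy_inner (\<lambda>w. b w * f w) (\<lambda>w. b w * g w) = hardy_inner f g"
proof (rule eq_by_polarization)
  fix t :: complex
  have hol: "b holomorphic_on ball 0 1"
    and iso: "h \<in> hardy \<Longrightarrow> hardy_norm (\<lambda>w. b w * h w) = hardy_norm h" for h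
    using b(1) by (auto simp: inner_function_def)
  note mem = hardy_mult_bounded(1)[OF hol b(2)]
  have "hardy_norm (\<lambda>w. b w * f w + t * (b w * g w)) = hardy_norm (\<lambda>w. f w + t * g w)"
    using iso[OF hardy_lincomb(1)[OF assms(3,4)], of t] by (simp add: algebra_simps)
  then show "Re (cnj t * hardy_inner (\<lambda>w. b w * f w) (\<lambda>w. b w * g w)) = Re (cnj t * hardy_inner f g)"
    using hardy_norm_lincomb[OF mem[OF assms(3)] mem[OF assms(4)], of t]
      hardy_norm_lincomb[OF assms(3,4), of t] iso assms(3,4) by simp
qed


section \<open>Projections of monomials onto the model space\<close>

text \<open>
  For an inner function \<open>b\<close> the projection of \<open>H\<^sup>2\<close> onto the orthogonal complement of
  \<open>b H\<^sup>2\<close> is \<open>f - b P (cnj b f)\<close>, with \<open>P\<close> the Riesz projection. For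
  \<open>f = w ^ n\<close> the term \<open>P (cnj b f)\<close> is the polynomial below.
\<close>

definition toeplitz_poly :: "(complex \<Rightarrow> complex) \<Rightarrow> nat \<Rightarrow> complex \<Rightarrow> complex" where
  "toeplitz_poly b n = hardy_series (\<lambda>j. if j \<le> n then cnj (hardy_coeff b (n - j)) else 0)"

definition model_monomial :: "(complex \<Rightarrow> complex) \<Rightarrow> nat \<Rightarrow> complex \<Rightarrow> complex" where
  "model_monomial b n = (\<lambda>w. hardy_series (\<lambda>j. if j = n then 1 else 0) w - b w * toeplitz_poly b n w)"

lemma toeplitz_poly:
  "toeplitz_poly b n \<in> hardy"
  "hardy_coeff (toeplitz_poly b n) = (\<lambda>j. if j \<le> n then cnj (hardy_coeff b (n - j)) else 0)"
proof -
  have "square_summable (\<lambda>j. if j \<le> n then cnj (hardy_coeff b (n - j)) else 0)"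
    by (rule summable_finite[of "{..n}"]) auto
  note hardy_series[OF this]
  then show "toeplitz_poly b n \<in> hardy"
    "hardy_coeff (toeplitz_poly b n) = (\<lambda>j. if j \<le> n then cnj (hardy_coeff b (n - j)) else 0)"
    by (simp_all add: toeplitz_poly_def)
qed

lemma hardy_monomial:
  "hardy_series (\<lambda>j. if j = n then 1 else 0) \<in> hardy"
  "hardy_coeff (hardy_series (\<lambda>j. if j = n then 1 else 0)) = (\<lambda>j. if j = n then 1 else 0)"
proof -
  have "square_summable (\<lambda>j. if j = n then 1 else 0)"
    by (rule summable_finite[of "{n}"]) auto
  note hardy_series[OF this]
  then show "hardy_series (\<lambda>j. if j = n then 1 else 0) \<in> hardy"
    "hardy_coeff (hardy_series (\<lambda>j. if j = n then 1 else 0)) = (\<lambda>j. if j = n then 1 else 0)"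
    by auto
qed

locale model_space =
  fixes b :: "complex \<Rightarrow> complex"
  assumes holomorphic: "b holomorphic_on ball 0 1"
    and bounded_by_1: "\<forall>w\<in>ball 0 1. cmod (b w) \<le> 1"
    and inner_or_zero: "inner_function b \<or> (\<forall>w\<in>ball 0 1. b w = 0)"
begin

lemmas mult_mem = hardy_mult_bounded(1)[OF holomorphic bounded_by_1]
  and mult_coeff = hardy_mult_bounded(2)[OF holomorphic bounded_by_1]

lemma model_monomial_mem: "model_monomial b n \<in> hardy"
  unfolding model_monomial_def
  using hardy_lincomb(1)[OF hardy_monomial(1) mult_mem[OF toeplitz_poly(1)], of n "-1" b n]
  by simp

lemma model_monomial_coeff_mult:
  "hardy_coeff (model_monomial b n) m
    = (if m = n then 1 else 0) - hardy_coeff (\<lambda>w. b w * toeplitz_poly b n w) m"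
  unfolding model_monomial_def
  using hardy_lincomb(2)[OF hardy_monomial(1) mult_mem[OF toeplitz_poly(1)], of n "-1" b n m]
  by (simp add: hardy_monomial)

lemma model_monomial_coeff:
  "hardy_coeff (model_monomial b n) m = (if m = n then 1 else 0)
    - (\<Sum>j\<le>m. (if j \<le> n then cnj (hardy_coeff b (n - j)) else 0) * hardy_coeff b (m - j))"
  unfolding model_monomial_coeff_mult mult_coeff[OF toeplitz_poly(1)] toeplitz_poly(2) ..

text \<open>
  For inner \<open>b\<close>, both terms of the projected monomial pair with \<open>b f\<close> to the conjugate of the \<open>n\<close>-th
  coefficient of \<open>b f\<close>: the monomial by definition, the other one because multiplication by
  \<open>b\<close> is isometric.
\<close>

lemma model_monomial_orthogonal:
  assumes f: "f \<in> hardy"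
  shows "hardy_inner (model_monomial b n) (\<lambda>w. b w * f w) = 0"
proof (cases "inner_function b")
  case True
  let ?q = "toeplitz_poly b n" and ?bf = "hardy_coeff (\<lambda>w. b w * f w)"
  have "hardy_inner (\<lambda>w. b w * ?q w) (\<lambda>w. b w * f w) = hardy_inner ?q f"
    by (intro inner_function_isometry True bounded_by_1 toeplitz_poly f)
  also have "\<dots> = (\<Sum>j\<le>n. cnj (hardy_coeff b (n - j)) * cnj (hardy_coeff f j))"
    unfolding hardy_inner_def toeplitz_poly by (subst suminf_finite[of "{..n}"]) auto
  also have "\<dots> = cnj (?bf n)"
    by (simp add: mult_coeff[OF f] mult.commute)
  finally have q: "(\<Sum>m. hardy_coeff (\<lambda>w. b w * ?q w) m * cnj (?bf m)) = cnj (?bf n)"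
    by (simp add: hardy_inner_def)
  have "(\<lambda>m. (if m = n then 1 else 0) * cnj (?bf m)) sums cnj (?bf n)"
    using sums_single[of n "\<lambda>m. cnj (?bf m)"] by (simp add: if_distrib[of "\<lambda>x. x * _"] cong: if_cong)
  moreover have "summable (\<lambda>m. hardy_coeff (\<lambda>w. b w * ?q w) m * cnj (?bf m))"
    by (intro square_summable_mult hardyD mult_mem toeplitz_poly f)
  ultimately have "(\<lambda>m. hardy_coeff (model_monomial b n) m * cnj (?bf m)) sums 0"
    using sums_diff[OF _ summable_sums] q by (fastforce simp: model_monomial_coeff_mult left_diff_distrib)
  then show ?thesis
    by (simp add: hardy_inner_def sums_iff)
next
  case False
  then have "b w * f w = 0" for w
    using inner_or_zero hardyD(3)[OF f] by (metis mult_zero_left mult_zero_right)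
  then have "(\<lambda>w. b w * f w) = (\<lambda>w. 0)"
    by (rule ext)
  then show ?thesis
    by (simp add: hardy_inner_def hardy_coeff_zero)
qed

text \<open>
  A function orthogonal to \<open>b H\<^sup>2\<close> sees only the monomial in the projected monomial. Hence the
  projected monomials represent the coefficient functionals of the model space.
\<close>

lemma model_monomial_reproducing:
  assumes h: "h \<in> hardy" and orth: "\<And>f. f \<in> hardy \<Longrightarrow> hardy_inner h (\<lambda>w. b w * f w) = 0"
  shows "hardy_inner h (model_monomial b n) = hardy_coeff h n"
proof -
  let ?q = "hardy_coeff (\<lambda>w. b w * toeplitz_poly b n w)"
  have "(\<lambda>m. hardy_coeff h m * (if m = n then 1 else 0)) sums hardy_coeff h n"
    using sums_single[of n "hardy_coeff h"] by (simp add: if_distrib[of "\<lambda>x. _ * x"] cong: if_cong)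
  moreover have "summable (\<lambda>m. hardy_coeff h m * cnj (?q m))"
    by (intro square_summable_mult hardyD mult_mem toeplitz_poly h)
  then have "(\<lambda>m. hardy_coeff h m * cnj (?q m)) sums 0"
    using orth[OF toeplitz_poly(1)] by (simp add: hardy_inner_def sums_iff)
  ultimately have "(\<lambda>m. hardy_coeff h m * (if m = n then 1 else 0) - hardy_coeff h m * cnj (?q m))
      sums (hardy_coeff h n - 0)"
    by (rule sums_diff)
  moreover have "hardy_coeff h m * (if m = n then 1 else 0) - hardy_coeff h m * cnj (?q m)
      = hardy_coeff h m * cnj (hardy_coeff (model_monomial b n) m)" for m
    by (simp add: model_monomial_coeff_mult right_diff_distrib)
  ultimately show ?thesis
    by (simp add: hardy_inner_def sums_iff)
qed

lemma model_monomial_norm: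
  "(\<Sum>m. (cmod (hardy_coeff (model_monomial b n) m))\<^sup>2) = Re (hardy_coeff (model_monomial b n) n)"
proof -
  let ?a = "hardy_coeff (model_monomial b n)"
  have "(\<lambda>m. ?a m * cnj (?a m)) sums hardy_inner (model_monomial b n) (model_monomial b n)"
    unfolding hardy_inner_def by (intro summable_sums square_summable_mult hardyD model_monomial_mem)
  then have "(\<lambda>m. ?a m * cnj (?a m)) sums ?a n"
    by (simp add: model_monomial_reproducing model_monomial_mem model_monomial_orthogonal)
  then have "(\<lambda>m. Re (?a m * cnj (?a m))) sums Re (?a n)"
    by (rule sums_Re)
  then show ?thesis
    unfolding complex_mult_cnj cmod_power2 by (simp add: sums_iff)
qed

end

text \<open>
  The projected monomials move continuously even where \<open>b\<close> jumps from inner to zero and the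
  norm of \<open>b\<close> jumps from one to zero: their squared norms are among their own coefficients.
\<close>

lemma model_monomial_continuous:
  fixes b :: "'x :: t2_space \<Rightarrow> complex \<Rightarrow> complex"
  assumes b: "\<And>x. model_space (b x)"
    and cont: "\<And>n. continuous_on UNIV (\<lambda>x. hardy_coeff (b x) n)"
  shows "(\<lambda>x. model_monomial (b x) n) \<in> continuous_hardy"
proof -
  let ?a = "\<lambda>x. hardy_coeff (model_monomial (b x) n)"
  note mem = model_space.model_monomial_mem[OF b]
  have coeff: "((\<lambda>y. ?a y m) \<longlongrightarrow> ?a x m) (at x)" for x m
  proof -
    have c: "((\<lambda>y. hardy_coeff (b y) k) \<longlongrightarrow> hardy_coeff (b x) k) (at x)" for k
      using cont by (simp add: continuous_on_def)
    have "((\<lambda>y. if j \<le> n then cnj (hardy_coeff (b y) (n - j)) else 0) \<longlongrightarrow>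
        (if j \<le> n then cnj (hardy_coeff (b x) (n - j)) else 0)) (at x)" for j
      by (cases "j \<le> n") (auto intro!: tendsto_intros c)
    then show ?thesis
      unfolding model_space.model_monomial_coeff[OF b] by (intro tendsto_intros c)
  qed
  have "((\<lambda>y. hardy_norm (\<lambda>w. model_monomial (b y) n w - model_monomial (b x) n w)) \<longlongrightarrow> 0) (at x)" for x
  proof -
    have "((\<lambda>y. \<Sum>m. (cmod (?a y m - ?a x m))\<^sup>2) \<longlongrightarrow> 0) (at x)"
    proof (rule square_norm_diff_tendsto_0)
      show "((\<lambda>y. \<Sum>m. (cmod (?a y m))\<^sup>2) \<longlongrightarrow> (\<Sum>m. (cmod (?a x m))\<^sup>2)) (at x)"
        unfolding model_space.model_monomial_norm[OF b] by (intro tendsto_intros coeff)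
    qed (intro hardyD mem coeff)+
    from tendsto_real_sqrt[OF this] show ?thesis
      using hardy_lincomb(2)[OF mem mem, of _ n "-1" x n] by (simp add: hardy_norm_def)
  qed
  with mem show ?thesis
    by (simp add: continuous_hardy_def)
qed

lemma constant_continuous_hardy: "f \<in> hardy \<Longrightarrow> (\<lambda>x. f) \<in> continuous_hardy"
  by (simp add: continuous_hardy_def hardy_norm_def hardy_coeff_zero)


section \<open>Moments of Herglotz measures\<close>

definition moment :: "real measure \<Rightarrow> nat \<Rightarrow> complex" where
  "moment \<mu> n = (\<integral>y. exp (- 2 * pi * \<i> * y) ^ n \<partial>\<mu>)"

lemma measurable_character_power:
  fixes \<mu> :: "real measure"
  assumes "sets \<mu> = sets (restrict_space borel A)"
  shows "(\<lambda>y. exp (- 2 * pi * \<i> * complex_of_real y) ^ n) \<in> borel_measurable \<mu>"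
proof -
  have "continuous_on UNIV (\<lambda>y. exp (- 2 * pi * \<i> * complex_of_real y) ^ n)"
    by (intro continuous_intros)
  then have "(\<lambda>y. exp (- 2 * pi * \<i> * complex_of_real y) ^ n) \<in> borel_measurable borel"
    by (rule borel_measurable_continuous_onI)
  then have "(\<lambda>y. exp (- 2 * pi * \<i> * complex_of_real y) ^ n) \<in> borel_measurable (restrict_space borel A)"
    by (rule measurable_restrict_space1)
  then show ?thesis
    unfolding measurable_cong_sets[OF assms refl] .
qed

lemma moment_series:
  assumes "prob_space \<mu>" "sets \<mu> = sets (restrict_space borel A)" and w: "cmod w < 1"
  shows "(\<lambda>n. moment \<mu> n * w ^ n) sums (\<integral>y. 1 / (1 - w * exp (- 2 * pi * \<i> * y)) \<partial>\<mu>)"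
    and "(\<integral>y. (1 + w * exp (- 2 * pi * \<i> * y)) / (1 - w * exp (- 2 * pi * \<i> * y)) \<partial>\<mu>)
      = 2 * (\<integral>y. 1 / (1 - w * exp (- 2 * pi * \<i> * y)) \<partial>\<mu>) - 1"
proof -
  interpret prob_space \<mu> by fact
  define z where "z y = exp (- 2 * pi * \<i> * complex_of_real y)" for y
  have z: "cmod (z y) = 1" for y
    by (simp add: z_def)
  have meas: "(\<lambda>y. z y ^ n) \<in> borel_measurable \<mu>" for n
    unfolding z_def by (rule measurable_character_power) fact
  have int: "integrable \<mu> (\<lambda>y. z y ^ n * w ^ n)" for n
    using meas by (intro integrable_mult_left integrable_const_bound[where B = 1])
      (auto simp: norm_power z)
  have norm: "norm (z y ^ n * w ^ n) = cmod w ^ n" for y n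
    by (simp add: norm_mult norm_power z)
  have geo: "(\<Sum>n. z y ^ n * w ^ n) = 1 / (1 - w * z y)" for y
    using suminf_geometric[of "w * z y"] w
    by (simp add: norm_mult z power_mult_distrib mult.commute)
  have ae: "AE y in \<mu>. summable (\<lambda>n. norm (z y ^ n * w ^ n))"
    unfolding norm using w by (simp add: summable_geometric)
  have sum: "summable (\<lambda>n. \<integral>y. norm (z y ^ n * w ^ n) \<partial>\<mu>)"
    unfolding norm using w by (simp add: summable_geometric prob_space)
  have "(\<lambda>n. \<integral>y. z y ^ n * w ^ n \<partial>\<mu>) sums (\<integral>y. 1 / (1 - w * z y) \<partial>\<mu>)"
    using sums_integral[OF int ae sum] by (simp only: geo)
  then show "(\<lambda>n. moment \<mu> n * w ^ n) sums (\<integral>y. 1 / (1 - w * exp (- 2 * pi * \<i> * y)) \<partial>\<mu>)"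
    by (simp add: moment_def z_def)
  have int': "integrable \<mu> (\<lambda>y. 1 / (1 - w * z y))"
    using integrable_suminf[OF int ae sum] by (simp only: geo)
  have "1 - w * z y \<noteq> 0" for y
  proof
    assume "1 - w * z y = 0"
    then have "cmod (w * z y) = 1"
      by simp
    with w show False
      by (simp add: norm_mult z)
  qed
  then have "(1 + w * z y) / (1 - w * z y) = 2 * (1 / (1 - w * z y)) - 1" for y
    by (simp add: field_simps)
  then have "(\<integral>y. (1 + w * z y) / (1 - w * z y) \<partial>\<mu>) = (\<integral>y. 2 * (1 / (1 - w * z y)) - 1 \<partial>\<mu>)"
    by simp
  also have "\<dots> = 2 * (\<integral>y. 1 / (1 - w * z y) \<partial>\<mu>) - 1"
    using int' by (subst Bochner_Integration.integral_diff) 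
      (simp_all add: prob_space del: times_divide_eq_right)
  finally show "(\<integral>y. (1 + w * exp (- 2 * pi * \<i> * y)) / (1 - w * exp (- 2 * pi * \<i> * y)) \<partial>\<mu>)
      = 2 * (\<integral>y. 1 / (1 - w * exp (- 2 * pi * \<i> * y)) \<partial>\<mu>) - 1"
    by (simp add: z_def)
qed

text \<open>
  Expanding both sides of the Herglotz formula in powers of \<open>w\<close> turns it into
  \<open>1 / (1 - b) = \<Sum>n. moment n * w ^ n\<close>.
\<close>

lemma herglotz_moments:
  assumes "herglotz_measure \<mu> b"
  shows "(1 - Abs_fps (hardy_coeff b)) * Abs_fps (moment \<mu>) = 1"
proof -
  have \<mu>: "prob_space \<mu>" "sets \<mu> = sets (restrict_space borel {0..<1})"
    and hol: "b holomorphic_on ball 0 1" and b0: "b 0 = 0"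
    and herglotz: "\<And>w. w \<in> ball 0 1 \<Longrightarrow> (1 + b w) / (1 - b w) =
      (\<integral>y. (1 + w * exp (- 2 * pi * \<i> * y)) / (1 - w * exp (- 2 * pi * \<i> * y)) \<partial>\<mu>)"
    using assms by (auto simp: herglotz_measure_def)
  define G where "G w = (\<integral>y. 1 / (1 - w * exp (- 2 * pi * \<i> * y)) \<partial>\<mu>)" for w
  have "G has_fps_expansion Abs_fps (moment \<mu>)"
    unfolding G_def using moment_series(1)[OF \<mu>] by (intro hardy_coeff_unique(1)) simp
  moreover have "b has_fps_expansion Abs_fps (hardy_coeff b)"
    using hardy_coeff_sums_holomorphic[OF hol] by (rule hardy_coeff_unique(1))
  ultimately have 1: "(\<lambda>w. (1 - b w) * G w) has_fps_expansion
      (1 - Abs_fps (hardy_coeff b)) * Abs_fps (moment \<mu>)"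
    by (intro fps_expansion_intros)
  have "isCont b 0"
    using hol by (intro holomorphic_on_imp_continuous_on[THEN continuous_on_interior]) auto
  then have "(b \<longlongrightarrow> 0) (nhds 0)"
    using b0 by (simp add: isCont_def tendsto_nhds_iff)
  then have "\<forall>\<^sub>F w in nhds 0. b w \<noteq> 1"
    using tendsto_imp_eventually_ne[of b 0 "nhds 0" 1] by simp
  moreover have "\<forall>\<^sub>F w in nhds 0. w \<in> ball (0 :: complex) 1"
    by (intro eventually_nhds_in_open) auto
  ultimately have "\<forall>\<^sub>F w in nhds 0. (1 - b w) * G w = 1"
  proof eventually_elim
    case (elim w)
    then have "2 * G w - 1 = (1 + b w) / (1 - b w)"
      using herglotz[of w] moment_series(2)[OF \<mu>, of w] by (simp add: G_def)
    with elim show ?case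
      by (simp add: field_simps) algebra
  qed
  then have "(\<lambda>w. (1 - b w) * G w) has_fps_expansion 1 \<longleftrightarrow> (\<lambda>w :: complex. 1 :: complex) has_fps_expansion 1"
    by (intro has_fps_expansion_cong) auto
  then show ?thesis
    using fps_expansion_unique_complex[OF 1] by simp
qed

lemma moment_0: "prob_space \<mu> \<Longrightarrow> moment \<mu> 0 = 1"
  by (simp add: moment_def prob_space.prob_space)

lemma moment_bound:
  assumes "prob_space \<mu>"
  shows "cmod (moment \<mu> n) \<le> 1"
proof -
  interpret prob_space \<mu> by fact
  have "cmod (moment \<mu> n) \<le> (\<integral>y. norm (exp (- 2 * pi * \<i> * complex_of_real y) ^ n) \<partial>\<mu>)"
    unfolding moment_def by (rule integral_norm_bound)
  then show ?thesis
    by (simp add: norm_power prob_space)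
qed

lemma moment_continuous:
  assumes "weakly_continuous \<mu>"
  shows "continuous_on UNIV (\<lambda>x. moment (\<mu> x) n)"
proof -
  let ?g = "\<lambda>y :: real. exp (- 2 * pi * \<i> * complex_of_real y) ^ n"
  have "continuous_on {0..<1} ?g"
    by (intro continuous_intros)
  moreover have "bounded (?g ` {0..<1})"
    unfolding bounded_iff by (intro exI[of _ 1]) (auto simp: norm_power)
  ultimately show ?thesis
    using assms unfolding weakly_continuous_def moment_def by blast
qed

text \<open>
  The identity \<open>(1 - b) * (\<Sum>n. moment n * w ^ n) = 1\<close> determines the coefficients of \<open>b\<close>
  recursively from the moments.
\<close>

lemma herglotz_coeff_continuous:
  assumes "\<And>x. herglotz_measure (\<mu> x) (b x)" "weakly_continuous \<mu>"
  shows "continuous_on UNIV (\<lambda>x. hardy_coeff (b x) n)"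
proof (induction n rule: less_induct)
  case (less n)
  have "hardy_coeff (b x) n
      = moment (\<mu> x) n - (if n = 0 then 1 else 0) - (\<Sum>i<n. hardy_coeff (b x) i * moment (\<mu> x) (n - i))" for x
  proof -
    have "fps_nth ((1 - Abs_fps (hardy_coeff (b x))) * Abs_fps (moment (\<mu> x))) n = fps_nth 1 n"
      using herglotz_moments[OF assms(1)] by simp
    then have "moment (\<mu> x) n - (\<Sum>i\<le>n. hardy_coeff (b x) i * moment (\<mu> x) (n - i)) = (if n = 0 then 1 else 0)"
      by (simp add: left_diff_distrib fps_mult_nth atLeast0AtMost fps_one_nth split: if_splits)
    moreover have "moment (\<mu> x) 0 = 1"
      using assms(1) by (intro moment_0) (simp add: herglotz_measure_def)
    ultimately show ?thesis
      by (simp add: lessThan_Suc_atMost[symmetric] algebra_simps)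
  qed
  then show ?case
    using less by (auto intro!: continuous_intros moment_continuous assms(2))
qed


section \<open>Toeplitz matrices\<close>

definition toeplitz :: "complex fps \<Rightarrow> nat \<Rightarrow> nat \<Rightarrow> complex" where
  "toeplitz f n j = (if j \<le> n then fps_nth f (n - j) else 0)"

lemma toeplitz_mult: "(\<Sum>i\<le>n. toeplitz f n i * toeplitz g i j) = toeplitz (f * g) n j"
proof (cases "j \<le> n")
  case True
  have "(\<Sum>i\<le>n. toeplitz f n i * toeplitz g i j) = (\<Sum>i\<in>{j..n}. fps_nth f (n - i) * fps_nth g (i - j))"
    by (rule sum.mono_neutral_cong_right) (auto simp: toeplitz_def)
  also have "\<dots> = (\<Sum>k\<in>{0..n - j}. fps_nth f (n - j - k) * fps_nth g k)"
    by (rule sum.reindex_bij_witness[of _ "\<lambda>k. k + j" "\<lambda>i. i - j"]) (use True in auto)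
  also have "\<dots> = fps_nth (g * f) (n - j)"
    by (simp add: fps_mult_nth mult.commute[of "fps_nth f _"])
  finally show ?thesis
    using True by (simp add: toeplitz_def mult.commute[of g f])
qed (auto simp: toeplitz_def intro!: sum.neutral)

text \<open>
  Write \<open>M\<close> and \<open>B\<close> for the lower triangular Toeplitz matrices of \<open>cnj m\<close> and \<open>cnj b\<close>. Then
  \<open>M (I - B B\<^sup>*) M\<^sup>* = M M\<^sup>* - (M - I) (M - I)\<^sup>* = M + M\<^sup>* - I\<close>, because \<open>M B = M - I\<close>.
\<close>

lemma toeplitz_gram:
  assumes inv: "(1 - b) * m = 1" and m0: "fps_nth m 0 = 1"
  shows "(\<Sum>i\<le>n. \<Sum>l\<le>k. cnj (toeplitz m n i) * toeplitz m k l *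
      ((if l = i then 1 else 0) - (\<Sum>j\<le>l. cnj (toeplitz b i j) * toeplitz b l j)))
    = (if k \<le> n then cnj (fps_nth m (n - k)) else fps_nth m (k - n))"
proof -
  define N where "N = n + k"
  have mb: "m * b = m - 1"
    using inv by (simp add: algebra_simps)
  have one: "toeplitz 1 i j = (if i = j then 1 else 0)" for i j
    by (auto simp: toeplitz_def)
  have low: "toeplitz f l j = 0" if "l < j" for f l j
    using that by (simp add: toeplitz_def)
  have diff: "toeplitz (f - g) i j = toeplitz f i j - toeplitz g i j" for f g i j
    by (simp add: toeplitz_def)
  have gram: "(if l = i then 1 else 0) - (\<Sum>j\<le>l. cnj (toeplitz b i j) * toeplitz b l j)
      = (\<Sum>j\<le>N. cnj (toeplitz 1 i j) * toeplitz 1 l j - cnj (toeplitz b i j) * toeplitz b l j)"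
    if "l \<le> k" for i l
  proof -
    have "(\<Sum>j\<le>l. cnj (toeplitz b i j) * toeplitz b l j) = (\<Sum>j\<le>N. cnj (toeplitz b i j) * toeplitz b l j)"
      using that by (intro sum.mono_neutral_left) (auto simp: N_def low)
    moreover have "(\<Sum>j\<le>N. cnj (toeplitz 1 i j) * toeplitz 1 l j) = (if l = i then 1 else 0)"
      using that by (simp add: one if_distrib[of "\<lambda>x. _ * x"] N_def cong: if_cong)
    ultimately show ?thesis
      by (simp add: sum_subtractf)
  qed
  have factor: "(\<Sum>i\<le>n. \<Sum>l\<le>k. cnj (toeplitz m n i) * toeplitz m k l * (cnj (toeplitz f i j) * toeplitz f l j))
      = cnj (toeplitz (m * f) n j) * toeplitz (m * f) k j" for f j
    unfolding toeplitz_mult[symmetric] cnj_sum sum_product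
    by (intro sum.cong) (simp_all add: mult_ac)
  have "(\<Sum>i\<le>n. \<Sum>l\<le>k. cnj (toeplitz m n i) * toeplitz m k l *
      ((if l = i then 1 else 0) - (\<Sum>j\<le>l. cnj (toeplitz b i j) * toeplitz b l j)))
    = (\<Sum>i\<le>n. \<Sum>l\<le>k. \<Sum>j\<le>N. cnj (toeplitz m n i) * toeplitz m k l * (cnj (toeplitz 1 i j) * toeplitz 1 l j)
        - cnj (toeplitz m n i) * toeplitz m k l * (cnj (toeplitz b i j) * toeplitz b l j))"
    by (intro sum.cong refl) (simp only: gram atMost_iff sum_distrib_left right_diff_distrib)
  also have "\<dots> = (\<Sum>i\<le>n. \<Sum>j\<le>N. \<Sum>l\<le>k. cnj (toeplitz m n i) * toeplitz m k l * (cnj (toeplitz 1 i j) * toeplitz 1 l j)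
        - cnj (toeplitz m n i) * toeplitz m k l * (cnj (toeplitz b i j) * toeplitz b l j))"
    by (intro sum.cong refl sum.swap)
  also have "\<dots> = (\<Sum>j\<le>N. \<Sum>i\<le>n. \<Sum>l\<le>k. cnj (toeplitz m n i) * toeplitz m k l * (cnj (toeplitz 1 i j) * toeplitz 1 l j)
        - cnj (toeplitz m n i) * toeplitz m k l * (cnj (toeplitz b i j) * toeplitz b l j))"
    by (rule sum.swap)
  also have "\<dots> = (\<Sum>j\<le>N. cnj (toeplitz m n j) * toeplitz m k j
      - (cnj (toeplitz m n j) - toeplitz 1 n j) * (toeplitz m k j - toeplitz 1 k j))"
    by (intro sum.cong refl) (simp only: sum_subtractf factor mult_1_right mb diff, simp add: one)
  also have "\<dots> = (\<Sum>j\<le>N. (if n = j then toeplitz m k j else 0) + (if k = j then cnj (toeplitz m n j) else 0)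
      - (if n = j then if k = j then 1 else 0 else 0))"
    by (intro sum.cong refl) (simp add: one algebra_simps)
  also have "\<dots> = toeplitz m k n + cnj (toeplitz m n k) - (if k = n then 1 else 0)"
    by (simp add: sum.distrib sum_subtractf N_def)
  also have "\<dots> = (if k \<le> n then cnj (fps_nth m (n - k)) else fps_nth m (k - n))"
    using m0 by (auto simp: toeplitz_def)
  finally show ?thesis .
qed


section \<open>Frames and stationary sequences in Hilbert C(X)-modules\<close>

lemma apply_bcontfun_sum:
  "apply_bcontfun (\<Sum>i\<in>A. f i) x = (\<Sum>i\<in>A. apply_bcontfun (f i) x)"
  by (induction A rule: infinite_finite_induct) auto

lemma tendsto_apply_bcontfun:
  assumes "(f \<longlongrightarrow> l) F"
  shows "((\<lambda>n. apply_bcontfun (f n) x) \<longlongrightarrow> apply_bcontfun l x) F"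
proof (rule tendstoI)
  fix e :: real
  assume "0 < e"
  with assms have "\<forall>\<^sub>F n in F. dist (f n) l < e"
    by (rule tendstoD)
  then show "\<forall>\<^sub>F n in F. dist (apply_bcontfun (f n) x) (apply_bcontfun l x) < e"
    by eventually_elim (rule le_less_trans[OF dist_bounded])
qed

context hilbert_CX_module
begin

lemma ip_diff_left: "ip (f - g) h = ip f h - ip g h"
  using ip_add_left[of "f - g" g h] by (simp add: algebra_simps)

lemma ip_zero_left: "ip 0 h = 0"
  using ip_diff_left[of 0 0 h] by simp

lemma ip_sum_left: "ip (\<Sum>i\<in>A. f i) h = (\<Sum>i\<in>A. ip (f i) h)"
  by (induction A rule: infinite_finite_induct) (auto simp: ip_zero_left ip_add_left)

lemma ip_add_right: "ip h (f + g) = ip h f + ip h g"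
  by (rule bcontfun_eqI) (simp add: ip_cnj[of h] ip_add_left)

lemma ip_diff_right: "ip h (f - g) = ip h f - ip h g"
  by (rule bcontfun_eqI) (simp add: ip_cnj[of h] ip_diff_left)

lemma ip_sum_right: "ip h (\<Sum>i\<in>A. f i) = (\<Sum>i\<in>A. ip h (f i))"
  by (rule bcontfun_eqI) (simp add: ip_cnj[of h] ip_sum_left apply_bcontfun_sum)

lemma ip_act_right: "apply_bcontfun (ip f (act a g)) x = cnj (apply_bcontfun a x) * apply_bcontfun (ip f g) x"
  by (simp add: ip_cnj[of f] ip_act_left)

lemma norm_act_le: "norm (act a h) \<le> norm a * norm h"
proof -
  have "norm (ip (act a h) (act a h)) \<le> (norm a)\<^sup>2 * norm (ip h h)"
  proof (rule norm_bound)
    fix x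
    have "norm (apply_bcontfun (ip (act a h) (act a h)) x)
        = (norm (apply_bcontfun a x))\<^sup>2 * norm (apply_bcontfun (ip h h) x)"
      by (simp add: ip_act_left ip_act_right norm_mult power2_eq_square)
    also have "\<dots> \<le> (norm a)\<^sup>2 * norm (ip h h)"
      by (intro mult_mono power_mono norm_bounded) auto
    finally show "norm (apply_bcontfun (ip (act a h) (act a h)) x) \<le> (norm a)\<^sup>2 * norm (ip h h)" .
  qed
  then have "sqrt (norm (ip (act a h) (act a h))) \<le> sqrt ((norm a)\<^sup>2 * norm (ip h h))"
    by (rule real_sqrt_le_mono)
  then show ?thesis
    by (simp add: norm_eq real_sqrt_mult)
qed

lemma tendsto_act:
  assumes "(f \<longlongrightarrow> l) F"
  shows "((\<lambda>n. act a (f n)) \<longlongrightarrow> act a l) F"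
proof (rule LIM_zero_cancel, rule Lim_null_comparison)
  show "\<forall>\<^sub>F n in F. norm (act a (f n) - act a l) \<le> norm a * norm (f n - l)"
    using norm_act_le[of a] by (simp flip: CX_module.scale_right_diff_distrib)
  show "((\<lambda>n. norm a * norm (f n - l)) \<longlongrightarrow> 0) F"
    using tendsto_mult[OF tendsto_const tendsto_norm_zero[OF LIM_zero[OF assms]], of "norm a"] by simp
qed

lemma parseval_pointwise:
  assumes "standard_parseval_frame ip F"
  shows "(\<lambda>n. (cmod (apply_bcontfun (ip f (F n)) x))\<^sup>2) sums Re (apply_bcontfun (ip f f) x)"
proof -
  have "(\<lambda>N. \<Sum>n<N. ip f (F n) * ip (F n) f) \<longlonglongrightarrow> ip f f"
    using assms by (simp add: standard_parseval_frame_def sums_def)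
  from tendsto_Re[OF tendsto_apply_bcontfun[OF this, of x]] show ?thesis
    by (simp add: sums_def apply_bcontfun_sum ip_cnj[of "F _" f] complex_mult_cnj cmod_power2
        del: times_complex.sel)
qed

lemma parseval_inner:
  assumes "standard_parseval_frame ip F"
  shows "(\<Sum>n. apply_bcontfun (ip f (F n)) x * cnj (apply_bcontfun (ip g (F n)) x))
    = apply_bcontfun (ip f g) x"
proof (rule eq_by_polarization)
  fix t :: complex
  let ?a = "\<lambda>f n. apply_bcontfun (ip f (F n)) x"
  let ?h = "f + act (const_bcontfun t) g"
  note parseval = parseval_pointwise[OF assms, of _ x]
  have ss: "square_summable (?a f)" "square_summable (?a g)"
    using parseval by (auto simp: sums_iff)
  have "?a ?h n = ?a f n + t * ?a g n" for n
    by (simp add: ip_add_left ip_act_left const_bcontfun.rep_eq)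
  then have "(\<lambda>n. (cmod (?a f n + t * ?a g n))\<^sup>2) sums Re (apply_bcontfun (ip ?h ?h) x)"
    using parseval[of ?h] by simp
  from sums_unique2[OF this square_norm_add_sums[OF ss, of t]]
  have "Re (apply_bcontfun (ip ?h ?h) x) = Re (apply_bcontfun (ip f f) x)
      + (cmod t)\<^sup>2 * Re (apply_bcontfun (ip g g) x) + 2 * Re (cnj t * (\<Sum>n. ?a f n * cnj (?a g n)))"
    unfolding sums_unique[OF parseval, symmetric] .
  moreover have "apply_bcontfun (ip ?h ?h) x = apply_bcontfun (ip f f) x + t * cnj t * apply_bcontfun (ip g g) x
      + (cnj t * apply_bcontfun (ip f g) x + cnj (cnj t * apply_bcontfun (ip f g) x))"
    by (simp add: ip_add_left ip_add_right ip_act_left ip_act_right const_bcontfun.rep_eq ip_cnj[of g f]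
        algebra_simps)
  then have "Re (apply_bcontfun (ip ?h ?h) x) = Re (apply_bcontfun (ip f f) x)
      + (cmod t)\<^sup>2 * Re (apply_bcontfun (ip g g) x) + 2 * Re (cnj t * apply_bcontfun (ip f g) x)"
    unfolding complex_norm_square[symmetric] by simp
  ultimately show "Re (cnj t * (\<Sum>n. ?a f n * cnj (?a g n))) = Re (cnj t * apply_bcontfun (ip f g) x)"
    by simp
qed

text \<open>
  Solving the recursion of the auxiliary sequence for \<open>e n\<close>, the terms with \<open>k < n\<close> cancel
  against the sum that is subtracted from \<open>f\<close>. The left side is the coefficient used in the
  Kaczmarz step number \<open>n\<close>.
\<close>

lemma residual_auxiliary:
  assumes "auxiliary_sequence act ip e F"
  shows "ip (f - (\<Sum>k<n. act (ip f (F k)) (e k))) (e n) = ip f (F n)"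
proof (rule bcontfun_eqI)
  fix x
  have e: "e n = F n + (\<Sum>k<n. act (ip (e n) (e k)) (F k))"
    using assms by (cases "n = 0") (auto simp: auxiliary_sequence_def)
  have "apply_bcontfun (ip f (e n)) x
      = apply_bcontfun (ip f (F n)) x + (\<Sum>k<n. apply_bcontfun (ip f (act (ip (e n) (e k)) (F k))) x)"
    by (subst e) (simp add: ip_add_right ip_sum_right apply_bcontfun_sum)
  then show "apply_bcontfun (ip (f - (\<Sum>k<n. act (ip f (F k)) (e k))) (e n)) x = apply_bcontfun (ip f (F n)) x"
    by (simp add: ip_diff_left ip_sum_left ip_act_left ip_act_right apply_bcontfun_sum ip_cnj[of "e n"]
        mult.commute)
qed

lemma kaczmarz_eq_sum:
  assumes "auxiliary_sequence act ip e F"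
  shows "kaczmarz act ip e f n = (\<Sum>k<Suc n. act (ip f (F k)) (e k))"
proof (induction n)
  case 0
  then show ?case
    using assms by (simp add: auxiliary_sequence_def)
next
  case (Suc n)
  then show ?case
    using residual_auxiliary[OF assms, of f "Suc n"] by simp
qed

text \<open>
  Each Kaczmarz step removes the component of the residual along a unit vector.
\<close>

lemma residual_norm:
  assumes unit: "\<And>n. ip (e n) (e n) = 1" and aux: "auxiliary_sequence act ip e F"
  defines "r \<equiv> \<lambda>f n. f - (\<Sum>k<n. act (ip f (F k)) (e k))"
  shows "ip (r f n) (r f n) = ip f f - (\<Sum>k<n. ip f (F k) * ip (F k) f)"
proof (induction n)
  case (Suc n)
  have "r f (Suc n) = r f n - act (ip f (F n)) (e n)"
    by (simp add: r_def)
  moreover have re: "ip (r f n) (e n) = ip f (F n)"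
    unfolding r_def by (rule residual_auxiliary[OF aux])
  have "ip (r f n - act (ip f (F n)) (e n)) (r f n - act (ip f (F n)) (e n))
      = ip (r f n) (r f n) - ip f (F n) * ip (F n) f"
    by (rule bcontfun_eqI)
      (simp add: ip_diff_left ip_diff_right ip_act_left ip_act_right re unit ip_cnj[of "e n" "r f n"]
        ip_cnj[of "F n" f])
  ultimately show ?case
    using Suc by simp
qed (simp add: r_def)

lemma parseval_auxiliary_expansion:
  assumes unit: "\<And>n. ip (e n) (e n) = 1" and aux: "auxiliary_sequence act ip e F"
    and parseval: "standard_parseval_frame ip F"
  shows "(\<lambda>k. act (ip f (F k)) (e k)) sums f"
proof -
  have "(\<lambda>n. ip f f - (\<Sum>k<n. ip f (F k) * ip (F k) f)) \<longlonglongrightarrow> ip f f - ip f f"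
    using parseval by (intro tendsto_intros) (simp add: standard_parseval_frame_def sums_def)
  then have "(\<lambda>n. sqrt (norm (ip f f - (\<Sum>k<n. ip f (F k) * ip (F k) f)))) \<longlonglongrightarrow> sqrt (norm (ip f f - ip f f))"
    by (intro tendsto_real_sqrt tendsto_norm)
  then have "(\<lambda>n. norm (f - (\<Sum>k<n. act (ip f (F k)) (e k)))) \<longlonglongrightarrow> 0"
    unfolding norm_eq residual_norm[OF unit aux] by simp
  then show ?thesis
    unfolding sums_def by (subst (asm) norm_minus_commute) (rule LIM_zero_cancel, rule tendsto_norm_zero_cancel)
qed

lemma effective_of_parseval:
  assumes unit: "\<And>n. ip (e n) (e n) = 1" and aux: "auxiliary_sequence act ip e F"
    and parseval: "standard_parseval_frame ip F"
  shows "effective act ip e"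
proof -
  have "kaczmarz act ip e f \<longlonglongrightarrow> f" for f
    using LIMSEQ_Suc[OF parseval_auxiliary_expansion[OF assms, of f, unfolded sums_def]]
    unfolding kaczmarz_eq_sum[OF aux, abs_def] .
  with unit show ?thesis
    by (simp add: effective_def)
qed

lemma norm_shift:
  assumes "\<And>n k. ip (e (Suc n)) (e (Suc k)) = ip (e n) (e k)"
  shows "norm (\<Sum>k\<in>A. act (a k) (e (Suc k))) = norm (\<Sum>k\<in>A. act (a k) (e k))"
proof -
  have "ip (\<Sum>k\<in>A. act (a k) (e (Suc k))) (\<Sum>k\<in>A. act (a k) (e (Suc k)))
      = ip (\<Sum>k\<in>A. act (a k) (e k)) (\<Sum>k\<in>A. act (a k) (e k))"
    by (rule bcontfun_eqI)
      (simp add: ip_sum_left ip_sum_right ip_act_left ip_act_right apply_bcontfun_sum assms)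
  then show ?thesis
    by (simp add: norm_eq)
qed

text \<open>
  A shift of the indices preserves the norm of finite combinations of \<open>e\<close>. Defining \<open>T\<close>
  by the expansion, rather than on the span of \<open>e\<close>, makes it well defined although the
  \<open>e n\<close> may be linearly dependent.
\<close>

lemma stationary_of_toeplitz:
  assumes toeplitz: "\<And>n k. ip (e (Suc n)) (e (Suc k)) = ip (e n) (e k)"
    and expansion: "\<And>f. (\<lambda>k. act (ip f (F k)) (e k)) sums f"
  shows "stationary act e"
proof -
  have summable: "summable (\<lambda>k. act (ip f (F k)) (e (Suc k)))" for f
    using sums_summable[OF expansion, of f] unfolding summable_Cauchy norm_shift[of e, OF toeplitz] .
  define T where "T f = (\<Sum>k. act (ip f (F k)) (e (Suc k)))" for f
  have T: "(\<lambda>n. \<Sum>k<n. act (ip f (F k)) (e (Suc k))) \<longlonglongrightarrow> T f" for f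
    unfolding T_def by (rule summable_LIMSEQ[OF summable])
  have add: "T (f + g) = T f + T g" for f g
    using suminf_add[OF summable summable, of f g]
    by (simp add: T_def ip_add_left CX_module.scale_left_distrib)
  have act: "T (act a f) = act a (T f)" for a f
  proof (rule LIMSEQ_unique[OF T])
    show "(\<lambda>n. \<Sum>k<n. act (ip (act a f) (F k)) (e (Suc k))) \<longlonglongrightarrow> act a (T f)"
      using tendsto_act[OF T, of a f] by (simp add: ip_act_left CX_module.scale_sum_right)
  qed
  have isometry: "norm (T f) = norm f" for f
  proof (rule LIMSEQ_unique[OF tendsto_norm[OF T]])
    show "(\<lambda>n. norm (\<Sum>k<n. act (ip f (F k)) (e (Suc k)))) \<longlonglongrightarrow> norm f"
      using tendsto_norm[OF expansion[of f, unfolded sums_def]] unfolding norm_shift[of e, OF toeplitz] .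
  qed
  have step: "T (e n) = e (Suc n)" for n
  proof (rule LIMSEQ_unique[OF T])
    \<comment> \<open>Coefficients of the partial sum minus \<open>e n\<close>, so that the shift lemma covers the difference.\<close>
    define d where "d k = ip (e n) (F k) - (if k = n then 1 else 0)" for k
    have split: "(\<Sum>k<m. act (d k) (u k)) = (\<Sum>k<m. act (ip (e n) (F k)) (u k)) - u n"
      if "n < m" for m and u :: "nat \<Rightarrow> 'h"
    proof -
      have "(\<Sum>k<m. act (if k = n then 1 else 0) (u k)) = (\<Sum>k<m. if k = n then u k else 0)"
        by (intro sum.cong) auto
      then show ?thesis
        using that by (simp add: d_def CX_module.scale_left_diff_distrib sum_subtractf)
    qed
    have "(\<lambda>m. norm ((\<Sum>k<m. act (ip (e n) (F k)) (e k)) - e n)) \<longlonglongrightarrow> 0"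
      by (rule tendsto_norm_zero[OF LIM_zero[OF expansion[of "e n", unfolded sums_def]]])
    moreover have "\<forall>\<^sub>F m in sequentially. norm ((\<Sum>k<m. act (ip (e n) (F k)) (e k)) - e n)
        = norm ((\<Sum>k<m. act (ip (e n) (F k)) (e (Suc k))) - e (Suc n))"
      using eventually_gt_at_top[of n]
    proof eventually_elim
      case (elim m)
      show ?case
        using norm_shift[of e, OF toeplitz, of d "{..<m}"]
        unfolding split[OF elim, of e] split[OF elim, of "\<lambda>k. e (Suc k)"] by (rule sym)
    qed
    ultimately have "(\<lambda>m. norm ((\<Sum>k<m. act (ip (e n) (F k)) (e (Suc k))) - e (Suc n))) \<longlonglongrightarrow> 0"
      by (rule Lim_transform_eventually)
    then show "(\<lambda>m. \<Sum>k<m. act (ip (e n) (F k)) (e (Suc k))) \<longlonglongrightarrow> e (Suc n)"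
      by (rule LIM_zero_cancel[OF tendsto_norm_zero_cancel])
  qed
  have "(T ^^ n) (e 0) = e n" for n
    by (induction n) (simp_all add: step)
  moreover have "module_hom act act T"
    using add act by unfold_locales auto
  ultimately show ?thesis
    unfolding stationary_def using isometry by blast
qed

end


section \<open>The effective stationary sequence\<close>

text \<open>
  The projected monomials form a continuous section in the range of the analysis operator, hence
  come from some \<open>P\<close>. By the reproducing property \<open>P\<close> and \<open>F n\<close> have the same inner
  product with every \<open>f\<close>, so they are equal.
\<close>

lemma frame_gram_of_analysis_range:
  fixes act :: "('x :: t2_space \<Rightarrow>\<^sub>C complex) \<Rightarrow> 'h \<Rightarrow> 'h :: banach"
  assumes "hilbert_CX_module cscale act ip" and parseval: "standard_parseval_frame ip F"
    and model: "\<And>x. model_space (b x)"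
    and cont: "\<And>n. continuous_on UNIV (\<lambda>x. hardy_coeff (b x) n)"
    and range: "range (analysis_operator ip F) = orth_complement b"
  shows "apply_bcontfun (ip (F n) (F m)) x = hardy_coeff (model_monomial (b x) n) m"
proof -
  interpret hilbert_CX_module cscale act ip by fact
  have ss: "square_summable (\<lambda>n. apply_bcontfun (ip f (F n)) x)" for f x
    using parseval_pointwise[OF parseval] by (rule sums_summable)
  have analysis: "analysis_operator ip F f x = hardy_series (\<lambda>n. apply_bcontfun (ip f (F n)) x)" for f x
    by (simp add: analysis_operator_def hardy_series_def)
  have coeff: "hardy_coeff (analysis_operator ip F f x) n = apply_bcontfun (ip f (F n)) x" for f x n
    by (simp add: analysis hardy_series(2)[OF ss])
  have inner: "hardy_inner (analysis_operator ip F f x) (analysis_operator ip F g x) = apply_bcontfun (ip f g) x" for f g x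
    unfolding hardy_inner_def coeff by (rule parseval_inner[OF parseval])
  have orth: "hardy_inner (analysis_operator ip F f x) (\<lambda>w. b x w * g w) = 0" if "g \<in> hardy" for f g x
  proof -
    have "analysis_operator ip F f \<in> orth_complement b"
      using range by blast
    then show ?thesis
      using constant_continuous_hardy[OF that] by (auto simp: orth_complement_def)
  qed
  have "(\<lambda>x. model_monomial (b x) n) \<in> orth_complement b"
    unfolding orth_complement_def
    using model_monomial_continuous[OF model cont] model_space.model_monomial_orthogonal[OF model]
    by (auto simp: continuous_hardy_def)
  then obtain P where P: "analysis_operator ip F P = (\<lambda>x. model_monomial (b x) n)"
    using range by (metis rangeE)
  have "ip f P = ip f (F n)" for f
  proof (rule bcontfun_eqI)
    fix x
    have "apply_bcontfun (ip f P) x = hardy_inner (analysis_operator ip F f x) (model_monomial (b x) n)"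
      using inner[of f x P] P by simp
    also have "\<dots> = hardy_coeff (analysis_operator ip F f x) n"
      using orth hardy_series(1)[OF ss] by (intro model_space.model_monomial_reproducing[OF model]) (simp_all add: analysis)
    finally show "apply_bcontfun (ip f P) x = apply_bcontfun (ip f (F n)) x"
      by (simp add: coeff)
  qed
  then have "ip (P - F n) (P - F n) = 0"
    by (simp add: ip_diff_right)
  then have "P = F n"
    using ip_definite by fastforce
  then show ?thesis
    using coeff[of P x m] P by simp
qed

theorem corollary5p2:
  fixes cscale :: "complex \<Rightarrow> 'h \<Rightarrow> 'h :: banach"
    and act :: "('x :: t2_space \<Rightarrow>\<^sub>C complex) \<Rightarrow> 'h \<Rightarrow> 'h"
    and ip :: "'h \<Rightarrow> 'h \<Rightarrow> ('x \<Rightarrow>\<^sub>C complex)"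
    and F :: "nat \<Rightarrow> 'h"
    and b :: "'x \<Rightarrow> complex \<Rightarrow> complex"
    and \<mu> :: "'x \<Rightarrow> real measure"
  assumes "compact (UNIV :: 'x set)"
    and "hilbert_CX_module cscale act ip"
    and "standard_parseval_frame ip F"
    and "\<And>x. (inner_function (b x) \<and> b x 0 = 0) \<or> (\<forall>w\<in>ball 0 1. b x w = 0)"
    and "\<And>x. herglotz_measure (\<mu> x) (b x)"
    and "weakly_continuous \<mu>"
    and "range (analysis_operator ip F) = orth_complement b"
  shows "\<exists>e. stationary act e \<and> effective act ip e \<and> auxiliary_sequence act ip e F"
proof -
  interpret hilbert_CX_module cscale act ip by fact
  have model: "model_space (b x)" for x
    using assms(4,5)[of x] by unfold_locales (auto simp: herglotz_measure_def)
  have prob: "prob_space (\<mu> x)" for x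
    using assms(5)[of x] by (simp add: herglotz_measure_def)
  define c where "c n = Bcontfun (\<lambda>x. cnj (moment (\<mu> x) n))" for n
  have c: "apply_bcontfun (c n) x = cnj (moment (\<mu> x) n)" for n x
    unfolding c_def
    by (subst Bcontfun_inverse)
      (auto intro!: bcontfun_normI[of _ 1] continuous_intros moment_continuous assms(6) simp: moment_bound prob)
  have c0: "c 0 = 1"
    by (rule bcontfun_eqI) (simp add: c moment_0 prob)
  define e where "e n = (\<Sum>i\<le>n. act (c (n - i)) (F i))" for n
  have frame: "apply_bcontfun (ip (F i) (F l)) x = (if l = i then 1 else 0)
      - (\<Sum>j\<le>l. cnj (toeplitz (Abs_fps (hardy_coeff (b x))) i j) * toeplitz (Abs_fps (hardy_coeff (b x))) l j)"
    for i l x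
    unfolding frame_gram_of_analysis_range[OF assms(2,3) model herglotz_coeff_continuous[OF assms(5,6)] assms(7)]
      model_space.model_monomial_coeff[OF model]
    by (auto simp: toeplitz_def intro!: sum.cong)
  have gram: "apply_bcontfun (ip (e n) (e k)) x
      = (if k \<le> n then cnj (moment (\<mu> x) (n - k)) else moment (\<mu> x) (k - n))" for n k x
  proof -
    let ?M = "toeplitz (Abs_fps (moment (\<mu> x)))"
    have "apply_bcontfun (ip (e n) (e k)) x
        = (\<Sum>i\<le>n. \<Sum>l\<le>k. cnj (?M n i) * ?M k l * apply_bcontfun (ip (F i) (F l)) x)"
      by (subst sum.swap) (simp add: e_def ip_sum_left ip_sum_right ip_act_left ip_act_right apply_bcontfun_sum c
          toeplitz_def sum_distrib_left mult.assoc)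
    then show ?thesis
      unfolding frame
      using toeplitz_gram[OF herglotz_moments[OF assms(5)], of x n k] by (simp add: moment_0 prob)
  qed
  have unit: "ip (e n) (e n) = 1" for n
    by (rule bcontfun_eqI) (simp add: gram moment_0 prob)
  have shift: "ip (e (Suc n)) (e (Suc k)) = ip (e n) (e k)" for n k
    by (rule bcontfun_eqI) (simp add: gram)
  have "ip (e n) (e k) = c (n - k)" if "k < n" for n k
    using that by (intro bcontfun_eqI) (simp add: gram c)
  then have aux: "auxiliary_sequence act ip e F"
    by (simp add: auxiliary_sequence_def e_def c0 lessThan_Suc_atMost[symmetric])
  have "stationary act e"
    using shift parseval_auxiliary_expansion[OF unit aux assms(3)] by (rule stationary_of_toeplitz)
  with effective_of_parseval[OF unit aux assms(3)] aux show ?thesis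
    by blast
qed

end
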